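(* Let $K:(0,\infty)\to\mathbb{R}$ be $C^1$ and strictly decreasing with $\int_0^1 K(r)\,r\,dr<\infty$, and let $D(\Omega)=\int_\Omega\int_\Omega K(|x-y|)\,dx\,dy$. Let $a,b,h>0$, and let $\Omega=\triangle_{ABC}\subset\mathbb{R}^2$ be the triangle with vertices $A=(-b,h)$, $B=(a,0)$, $C=(-a,0)$. For $t\in\mathbb{R}$ let $A_t=((t-1)b,h)$ and $\Omega_t=\triangle_{A_tBC}$. Then $t\mapsto D(\Omega_t)$ is strictly increasing for $-\infty<t\le1$.
   Context: $\triangle_{ABC}$ denotes the triangular region with vertices $A,B,C$. The condition $\int_0^1K(r)r\,dr<\infty$ guarantees that $D$ is finite on bounded planar domains. *)

theory Defs
  imports "HOL-Analysis.Analysis"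
begin

text \<open>
  The plane is the type \<^typ>\<open>real \<times> real\<close>, whose norm is the Euclidean one and whose
  \<^term>\<open>lborel\<close> is the two-dimensional Lebesgue measure.
\<close>

definition triangular_region :: "real \<times> real \<Rightarrow> real \<times> real \<Rightarrow> real \<times> real \<Rightarrow> (real \<times> real) set" where
  "triangular_region A B C = convex hull {A, B, C}"

text \<open>
  A kernel on \<open>(0, \<infinity>)\<close> is a total function on the reals; only its values on
  \<open>{0<..}\<close> matter, since for each \<open>x\<close> the inner integral meets \<open>K 0\<close> only on the null set
  \<open>{x}\<close>. If \<open>K\<close> is continuous on \<open>{0<..}\<close> and \<open>K r * r\<close> is integrable near \<open>0\<close>,
  both integrals converge absolutely for bounded Borel \<open>\<Omega>\<close>, so the default value \<open>0\<close> of
  divergent Bochner integrals does not come into play.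
\<close>

definition D :: "(real \<Rightarrow> real) \<Rightarrow> (real \<times> real) set \<Rightarrow> real" where
  "D K \<Omega> = (LINT x:\<Omega>|lborel. (LINT y:\<Omega>|lborel. K (norm (x - y))))"

end

theory Submission
  imports Defs
begin

text \<open>
  With a constant subtracted from \<open>K\<close>, the kernel is nonnegative on the triangles; the area of
  \<open>\<Omega>\<^sub>t\<close> does not depend on \<open>t\<close>, so the constant only shifts \<open>D\<close>. Slice the triangle by horizontal
  lines: the slice at height \<open>y\<close> is an interval with centre \<open>s y / h\<close> and half-length \<open>a (1 - y / h)\<close>,
  where \<open>s = (t - 1) b\<close>. For two heights \<open>y \<noteq> y'\<close> the kernel is an even function of \<open>x - x'\<close>, strictly
  decreasing in \<open>\<bar>x - x'\<bar>\<close>. Averaging such a function over an interval gives again such a function of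
  the centre; doing this in \<open>x'\<close> and in \<open>x\<close> shows that the interaction of the two slices
  strictly decreases with the distance \<open>\<bar>s\<bar> \<bar>y - y'\<bar> / h\<close> of their centres.
\<close>

section \<open>Radial integrals over a disc and finiteness of the shifted kernel\<close>

text \<open>This is integration in polar coordinates in measure form. Both measures are finite on
  the half-lines \<open>{x<..}\<close> and determined by them: there the left side is an area of a
  disc minus that of a smaller disc, and the right side is an increment of the primitive
  \<open>pi * r\<^sup>2\<close>.\<close>

lemma distr_norm_disc:
  assumes "0 \<le> R"
  shows "distr (density lborel (indicator (cball 0 R :: (real \<times> real) set))) borel norm
    = density lborel (\<lambda>r. ennreal (2 * pi * r) * indicator {0..R} r)" (is "?M = ?N")
proof (rule measure_eqI_lessThan)
  note borel_closed[OF closed_cball, measurable]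
  have M: "emeasure ?M {x<..} = emeasure lborel (cball 0 R \<inter> {z :: real \<times> real. x < norm z})" for x
  proof -
    have "emeasure ?M {x<..} = (\<integral>\<^sup>+z. indicator (cball 0 R \<inter> {z :: real \<times> real. x < norm z}) z \<partial>lborel)"
      by (subst emeasure_distr, simp, simp, subst emeasure_density, simp, measurable)
        (auto simp: indicator_inter_arith[symmetric] vimage_def intro!: nn_integral_cong
          split: split_indicator)
    then show ?thesis by simp
  qed
  have area: "emeasure lborel (cball (0::real \<times> real) r) = ennreal (pi * r\<^sup>2)" if "0 \<le> r" for r
    using that by (simp add: emeasure_cball eval_unit_ball_vol power2_eq_square)
  show "emeasure ?M {x<..} < \<infinity>" for x
  proof -
    have "emeasure ?M {x<..} \<le> emeasure lborel (cball (0::real \<times> real) R)"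
      unfolding M by (intro emeasure_mono) auto
    then show ?thesis using area[OF assms] by (simp add: le_less_trans)
  qed
  show "emeasure ?M {x<..} = emeasure ?N {x<..}" for x
  proof -
    \<comment> \<open>The open half-line is traded for a closed interval, as the fundamental theorem
      of calculus requires; the integrands differ at most at the null point
      \<open>x\<close>.\<close>
    have N: "emeasure ?N {x<..} = (\<integral>\<^sup>+r. ennreal (2 * pi * r) * indicator {max x 0..R} r \<partial>lborel)"
      by (subst emeasure_density, simp, simp, intro nn_integral_cong_AE)
        (use AE_lborel_singleton[of x] in eventually_elim, auto simp: indicator_def max_def)
    show ?thesis
    proof (cases "max x 0 \<le> R")
      case True
      have "emeasure ?N {x<..} = ennreal (pi * R\<^sup>2 - pi * (max x 0)\<^sup>2)"
        unfolding N by (rule nn_integral_FTC_Icc) (use True in \<open>auto intro!: derivative_eq_intros\<close>)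
      moreover have "emeasure ?M {x<..} = ennreal (pi * R\<^sup>2 - pi * (max x 0)\<^sup>2)"
      proof (cases "x < 0")
        case True
        then have "cball 0 R \<inter> {z :: real \<times> real. x < norm z} = cball 0 R"
          by (auto intro: less_le_trans)
        then show ?thesis using True area[OF assms] by (simp add: M)
      next
        case False
        then have "cball 0 R \<inter> {z :: real \<times> real. x < norm z} = cball 0 R - cball 0 x"
          by auto
        moreover have "emeasure lborel (cball (0::real \<times> real) R - cball 0 x)
            = emeasure lborel (cball (0::real \<times> real) R) - emeasure lborel (cball (0::real \<times> real) x)"
          using False True by (intro emeasure_Diff) (auto simp: area)
        ultimately show ?thesis using False True area[OF assms] by (simp add: M area ennreal_minus)
      qed
      ultimately show ?thesis by simp
    next
      case False
      then have "cball 0 R \<inter> {z :: real \<times> real. x < norm z} = {}" "{max x 0..R} = {}"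
        using assms by (auto simp: max_def split: if_splits)
      then show ?thesis by (simp add: M N)
    qed
  qed
qed auto

lemma nn_integral_radial:
  assumes "0 \<le> R" and [measurable]: "f \<in> borel_measurable borel"
  shows "(\<integral>\<^sup>+z. f (norm z) * indicator (cball 0 R) (z :: real \<times> real) \<partial>lborel)
    = (\<integral>\<^sup>+r. f r * ennreal (2 * pi * r) * indicator {0..R} r \<partial>lborel)"
proof -
  note borel_closed[OF closed_cball, measurable]
  have "(\<integral>\<^sup>+z. f (norm z) * indicator (cball 0 R) (z :: real \<times> real) \<partial>lborel)
      = integral\<^sup>N (distr (density lborel (indicator (cball 0 R :: (real \<times> real) set))) borel norm) f"
    by (subst nn_integral_distr, simp, simp, subst nn_integral_density)
      (auto simp: mult.commute)
  also have "\<dots> = (\<integral>\<^sup>+r. f r * ennreal (2 * pi * r) * indicator {0..R} r \<partial>lborel)"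
    unfolding distr_norm_disc[OF assms(1)]
    by (subst nn_integral_density) (auto simp: mult_ac)
  finally show ?thesis .
qed

lemma borel_measurable_kernel:
  fixes K :: "real \<Rightarrow> real"
  assumes "continuous_on {0<..} K"
  shows "(\<lambda>z :: real \<times> real. K (norm z)) \<in> borel_measurable borel"
proof -
  \<comment> \<open>Only continuity on \<open>{0<..}\<close> is given, so \<open>K\<close> is
    replaced by the constant \<open>K 0\<close> on the other reals. Norms are never negative, hence
    composing with \<open>norm\<close> gives the same function.\<close>
  have [measurable]: "(\<lambda>r. if r \<in> {0<..} then K r else K 0) \<in> borel_measurable borel"
    by (intro borel_measurable_continuous_on_if assms) auto
  have "(\<lambda>z :: real \<times> real. (\<lambda>r. if r \<in> {0<..} then K r else K 0) (norm z)) \<in> borel_measurable borel"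
    by measurable
  also have "(\<lambda>z :: real \<times> real. (\<lambda>r. if r \<in> {0<..} then K r else K 0) (norm z)) = (\<lambda>z. K (norm z))"
    by auto
  finally show ?thesis .
qed

text \<open>In polar coordinates the Jacobian supplies the factor \<open>r\<close>, and
  \<open>K r * r\<close> is integrable on \<open>{0<..1}\<close> by hypothesis and on
  \<open>{1..R}\<close> by continuity. Monotonicity makes \<open>K r - K R\<close> nonnegative for
  \<open>0 < r \<le> R\<close>, so integrability turns into a finite nonnegative integral.\<close>

lemma nn_integral_kernel_finite:
  fixes K :: "real \<Rightarrow> real"
  assumes cont: "continuous_on {0<..} K"
    and int: "set_integrable lborel {0<..1} (\<lambda>r. K r * r)"
    and anti: "\<And>r s. 0 < r \<Longrightarrow> r \<le> s \<Longrightarrow> K s \<le> K r" and "1 \<le> R"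
  shows "(\<integral>\<^sup>+z. ennreal (K (norm z) - K R) * indicator (cball 0 R) (z :: real \<times> real) \<partial>lborel) < \<infinity>"
proof -
  have "set_integrable lborel {1..R} (\<lambda>r. K r * r)"
    unfolding set_integrable_def
    by (rule borel_integrable_compact)
      (auto intro!: continuous_intros continuous_on_subset[OF cont])
  with int have "set_integrable lborel ({0<..1} \<union> {1..R}) (\<lambda>r. K r * r)"
    by (intro set_integrable_Un) auto
  also have "{0<..1} \<union> {1..R} = {0<..R}"
    using assms by auto
  finally have 1: "set_integrable lborel {0<..R} (\<lambda>r. K r * r)" .
  have "set_integrable lborel {0..R} (\<lambda>r. K R * r)"
    unfolding set_integrable_def
    by (rule borel_integrable_compact) (auto intro!: continuous_intros)
  then have "set_integrable lborel {0<..R} (\<lambda>r. K R * r)"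
    by (rule set_integrable_subset) auto
  with 1 have "set_integrable lborel {0<..R} (\<lambda>r. K r * r - K R * r)"
    by (rule set_integral_diff(1))
  then have "set_integrable lborel {0<..R} (\<lambda>r. (2 * pi) * (K r * r - K R * r))"
    by (intro set_integrable_mult_right) auto
  then have fin: "(\<integral>\<^sup>+r. ennreal (norm (indicator {0<..R} r *\<^sub>R ((2 * pi) * (K r * r - K R * r)))) \<partial>lborel) < \<infinity>"
    by (simp only: set_integrable_def integrable_iff_bounded)
  define k where "k r = ennreal ((if r \<in> {0<..} then K r else K 0) - K R)" for r
  have [measurable]: "(\<lambda>r. if r \<in> {0<..} then K r else K 0) \<in> borel_measurable borel"
    by (intro borel_measurable_continuous_on_if cont) auto
  have k: "k \<in> borel_measurable borel"
    unfolding k_def by measurable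
  have "(\<integral>\<^sup>+z. ennreal (K (norm z) - K R) * indicator (cball 0 R) (z :: real \<times> real) \<partial>lborel)
      = (\<integral>\<^sup>+z. k (norm z) * indicator (cball 0 R) (z :: real \<times> real) \<partial>lborel)"
    by (intro nn_integral_cong) (auto simp: k_def)
  also have "\<dots> = (\<integral>\<^sup>+r. k r * ennreal (2 * pi * r) * indicator {0..R} r \<partial>lborel)"
    using assms by (intro nn_integral_radial k) auto
  \<comment> \<open>The closed and the half-open interval agree here because the Jacobian vanishes
    at \<open>r = 0\<close>.\<close>
  also have "\<dots> = (\<integral>\<^sup>+r. ennreal (norm (indicator {0<..R} r *\<^sub>R ((2 * pi) * (K r * r - K R * r)))) \<partial>lborel)"
  proof (intro nn_integral_cong)
    fix r :: real
    show "k r * ennreal (2 * pi * r) * indicator {0..R} r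
      = ennreal (norm (indicator {0<..R} r *\<^sub>R ((2 * pi) * (K r * r - K R * r))))"
    proof (cases "0 < r \<and> r \<le> R")
      case True
      then have "0 \<le> K r - K R" using anti by simp
      then have "0 \<le> r * (K r - K R)" using True by simp
      then show ?thesis
        using True \<open>0 \<le> K r - K R\<close>
        by (simp add: k_def ennreal_mult[symmetric] abs_mult algebra_simps)
    next
      case False
      then show ?thesis by (auto simp: indicator_def)
    qed
  qed
  also note fin
  finally show ?thesis .
qed

section \<open>From \<open>D\<close> to a nonnegative double integral\<close>

text \<open>Split \<open>K = (K - c) + c\<close>. The constant contributes \<open>c\<close> times
  the squared area. The rest is nonnegative off the diagonal, and each inner integral is at most the
  integral over a disc of radius \<open>R\<close>, so \<open>N\<close> is at most this bound times
  the area; Bochner and nonnegative integrals then agree.\<close>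

lemma D_eq_nn_integral:
  fixes K :: "real \<Rightarrow> real" and \<Omega> :: "(real \<times> real) set" and c :: real
  defines "N \<equiv> \<integral>\<^sup>+x. (\<integral>\<^sup>+y. ennreal (K (norm (x - y)) - c) * indicator \<Omega> y \<partial>lborel) * indicator \<Omega> x \<partial>lborel"
  assumes [measurable]: "(\<lambda>z :: real \<times> real. K (norm z)) \<in> borel_measurable borel" "\<Omega> \<in> sets borel"
    and fin: "emeasure lborel \<Omega> < \<infinity>"
    and diam: "\<And>x y. x \<in> \<Omega> \<Longrightarrow> y \<in> \<Omega> \<Longrightarrow> norm (x - y) \<le> R"
    and ge: "\<And>r. 0 < r \<Longrightarrow> r \<le> R \<Longrightarrow> c \<le> K r"
    and int: "(\<integral>\<^sup>+z. ennreal (K (norm z) - c) * indicator (cball 0 R) (z :: real \<times> real) \<partial>lborel) < \<infinity>"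
  shows "N < \<infinity>" and "D K \<Omega> = enn2real N + c * (measure lborel \<Omega>)\<^sup>2"
proof -
  note borel_closed[OF closed_cball, measurable]
  define B where "B = (\<integral>\<^sup>+z. ennreal (K (norm z) - c) * indicator (cball 0 R) (z :: real \<times> real) \<partial>lborel)"
  define J where "J x = (\<integral>\<^sup>+y. ennreal (K (norm (x - y)) - c) * indicator \<Omega> y \<partial>lborel)" for x
  have [measurable]: "J \<in> borel_measurable borel"
    unfolding J_def by measurable
  have JB: "J x \<le> B" if "x \<in> \<Omega>" for x
  proof -
    \<comment> \<open>The diameter bound puts \<open>\<Omega>\<close> into the disc of radius
      \<open>R\<close> about \<open>x\<close>; reflecting \<open>y\<close> to \<open>x - y\<close>
      preserves Lebesgue measure and makes the bound independent of \<open>x\<close>.\<close>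
    have "J x \<le> (\<integral>\<^sup>+y. ennreal (K (norm (x - y)) - c) * indicator (cball 0 R) (x - y) \<partial>lborel)"
      unfolding J_def using diam that by (intro nn_integral_mono) (auto simp: indicator_def)
    also have "\<dots> = (\<integral>\<^sup>+y. ennreal (K (norm y) - c) * indicator (cball 0 R) y \<partial>distr lborel borel (\<lambda>y. x - y))"
      by (subst nn_integral_distr) auto
    also have "distr lborel borel (\<lambda>y. x - y) = (lborel :: (real \<times> real) measure)"
      using lborel_affine[of "-1" x] by (simp add: density_1)
    finally show ?thesis by (simp add: B_def)
  qed
  have N: "N = (\<integral>\<^sup>+x. J x * indicator \<Omega> x \<partial>lborel)"
    by (simp add: N_def J_def)
  also have "\<dots> \<le> (\<integral>\<^sup>+x. B * indicator \<Omega> x \<partial>lborel)"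
    using JB by (intro nn_integral_mono) (auto simp: indicator_def)
  also have "\<dots> = B * emeasure lborel \<Omega>"
    by (simp add: nn_integral_cmult_indicator)
  also have "\<dots> < \<infinity>"
    using int fin by (simp add: B_def ennreal_mult_less_top)
  finally show "N < \<infinity>" .
  have inner: "(LINT y:\<Omega>|lborel. K (norm (x - y))) = enn2real (J x) + c * measure lborel \<Omega>"
    if "x \<in> \<Omega>" for x
  proof -
    let ?g = "\<lambda>y. indicator \<Omega> y *\<^sub>R (K (norm (x - y)) - c)"
    \<comment> \<open>The sign of \<open>K 0 - c\<close> is unknown, so nonnegativity may fail at
      \<open>y = x\<close>, a null set.\<close>
    have ae: "AE y in lborel. 0 \<le> ?g y"
      using AE_lborel_singleton[of x]
      by eventually_elim (use ge diam that in \<open>auto simp: indicator_def\<close>)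
    have J: "(\<integral>\<^sup>+y. ennreal (?g y) \<partial>lborel) = J x"
      unfolding J_def by (intro nn_integral_cong) (auto simp: indicator_def)
    have g: "integrable lborel ?g"
    proof (rule integrableI_nonneg[OF _ ae])
      show "(\<integral>\<^sup>+y. ennreal (?g y) \<partial>lborel) < \<infinity>"
        unfolding J using JB[OF that] int unfolding B_def by (rule le_less_trans)
    qed measurable
    have ind: "integrable lborel (\<lambda>y. indicator \<Omega> y *\<^sub>R c)"
      using fin by simp
    have "(LINT y:\<Omega>|lborel. K (norm (x - y))) = integral\<^sup>L lborel (\<lambda>y. ?g y + indicator \<Omega> y *\<^sub>R c)"
      unfolding set_lebesgue_integral_def by (intro Bochner_Integration.integral_cong) (auto simp: indicator_def)
    also have "\<dots> = integral\<^sup>L lborel ?g + integral\<^sup>L lborel (\<lambda>y. indicator \<Omega> y *\<^sub>R c)"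
      by (intro Bochner_Integration.integral_add g ind)
    also have "integral\<^sup>L lborel ?g = enn2real (J x)"
      by (subst integral_eq_nn_integral[OF _ ae], measurable) (simp only: J)
    finally show ?thesis by simp
  qed
  let ?j = "\<lambda>x. indicator \<Omega> x *\<^sub>R enn2real (J x)"
  have nn: "(\<integral>\<^sup>+x. ennreal (?j x) \<partial>lborel) = N"
    unfolding N
  proof (intro nn_integral_cong)
    fix x
    \<comment> \<open>Finiteness matters because \<open>enn2real\<close> sends infinity to
      \<open>0\<close>.\<close>
    have "J x < \<infinity>" if "x \<in> \<Omega>"
      using JB[OF that] int by (simp add: B_def)
    then show "ennreal (?j x) = J x * indicator \<Omega> x"
      by (auto simp: indicator_def)
  qed
  have j: "integrable lborel ?j"
  proof (rule integrableI_nonneg)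
    show "(\<integral>\<^sup>+x. ennreal (?j x) \<partial>lborel) < \<infinity>"
      unfolding nn by fact
  qed (auto simp: indicator_def)
  have "D K \<Omega> = (LINT x:\<Omega>|lborel. (enn2real (J x) + c * measure lborel \<Omega>))"
    unfolding D_def using inner by (intro set_lebesgue_integral_cong) auto
  also have "\<dots> = integral\<^sup>L lborel (\<lambda>x. ?j x + indicator \<Omega> x *\<^sub>R (c * measure lborel \<Omega>))"
    unfolding set_lebesgue_integral_def by (simp add: scaleR_add_right algebra_simps)
  also have "\<dots> = integral\<^sup>L lborel ?j + integral\<^sup>L lborel (\<lambda>x. indicator \<Omega> x *\<^sub>R (c * measure lborel \<Omega>))"
    using fin by (intro Bochner_Integration.integral_add j) simp
  also have "integral\<^sup>L lborel ?j = enn2real N"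
    unfolding nn[symmetric] by (rule integral_eq_nn_integral) (auto simp: indicator_def)
  finally show "D K \<Omega> = enn2real N + c * (measure lborel \<Omega>)\<^sup>2"
    by (simp add: power2_eq_square)
qed

section \<open>Interaction of two intervals on a line\<close>

text \<open>For a primitive \<open>F\<close> of \<open>f\<close>, the integral is
  \<open>g (c - x)\<close> with \<open>g p = F (p + l) - F (p - l)\<close>. The derivative
  \<open>f (p + l) - f (p - l)\<close> is negative for \<open>p > 0\<close>, since then
  \<open>\<bar>p - l\<bar> < \<bar>p + l\<bar>\<close>. Nonnegativity is asked only on the interval
  because the shifted kernel becomes negative far away. As \<open>g\<close> inherits all properties
  of \<open>f\<close>, the lemma can be applied again to \<open>g\<close>.\<close>

lemma sliding_interval_integral:
  fixes f :: "real \<Rightarrow> real"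
  assumes cont: "continuous_on UNIV f" and even: "\<And>u. f (- u) = f u"
    and dec: "\<And>u v. \<bar>u\<bar> < \<bar>v\<bar> \<Longrightarrow> f v < f u" and l: "0 < l"
  obtains g where "continuous_on UNIV g" "\<And>u. g (- u) = g u"
    "\<And>u v. \<bar>u\<bar> < \<bar>v\<bar> \<Longrightarrow> g v < g u"
    "\<forall>c x. (\<forall>y\<in>{c - l..c + l}. 0 \<le> f (y - x)) \<longrightarrow> 0 \<le> g (c - x) \<and>
      (\<integral>\<^sup>+y. ennreal (f (y - x)) * indicator {c - l..c + l} y \<partial>lborel) = ennreal (g (c - x))"
proof -
  have "\<exists>F. \<forall>x :: real. - \<infinity> < ereal x \<longrightarrow> ereal x < \<infinity> \<longrightarrow> (F has_vector_derivative f x) (at x)"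
    by (rule einterval_antiderivative) (use cont in \<open>auto simp: continuous_on_eq_continuous_at\<close>)
  then obtain F where F: "(F has_real_derivative f x) (at x)" for x
    by (auto simp: has_real_derivative_iff_has_vector_derivative)
  note [derivative_intros] = DERIV_chain2[OF F]
  define g where "g p = F (p + l) - F (p - l)" for p
  have g': "(g has_real_derivative (f (p + l) - f (p - l))) (at p)" for p
    unfolding g_def by (auto intro!: derivative_eq_intros)
  \<comment> \<open>A primitive of an even function is odd up to a constant; this makes
    \<open>g\<close> even.\<close>
  have odd: "F x + F (- x) = F 0 + F 0" for x
  proof -
    have "((\<lambda>x. F x + F (- x)) has_real_derivative 0) (at x)" for x
      by (auto intro!: derivative_eq_intros simp: even)
    from DERIV_isconst_all[OF allI[OF this], of x 0] show ?thesis by simp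
  qed
  have geven: "g (- u) = g u" for u
    using odd[of "u + l"] odd[of "u - l"] by (simp add: g_def)
  have gdec: "g v < g u" if "0 \<le> u" "u < v" for u v
  proof (rule DERIV_neg_imp_decreasing_open[OF that(2)])
    fix x assume "u < x" "x < v"
    then show "\<exists>y. DERIV g x :> y \<and> y < 0"
      using g'[of x] dec[of "x - l" "x + l"] that l by (intro exI[of _ "f (x + l) - f (x - l)"]) auto
  qed (use g' in \<open>auto intro!: DERIV_isCont continuous_at_imp_continuous_on\<close>)
  show thesis
  proof
    show "continuous_on UNIV g"
      using g' by (auto intro!: DERIV_isCont continuous_at_imp_continuous_on)
    show "g (- u) = g u" for u by (rule geven)
    show "g v < g u" if "\<bar>u\<bar> < \<bar>v\<bar>" for u v
    proof -
      have "g \<bar>x\<bar> = g x" for x using geven[of x] by (simp add: abs_if)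
      with gdec[of "\<bar>u\<bar>" "\<bar>v\<bar>"] that show ?thesis by simp
    qed
    show "\<forall>c x. (\<forall>y\<in>{c - l..c + l}. 0 \<le> f (y - x)) \<longrightarrow> 0 \<le> g (c - x) \<and>
      (\<integral>\<^sup>+y. ennreal (f (y - x)) * indicator {c - l..c + l} y \<partial>lborel) = ennreal (g (c - x))"
    proof (intro allI impI)
    fix c x assume nn: "\<forall>y\<in>{c - l..c + l}. 0 \<le> f (y - x)"
    have F': "((\<lambda>y. F (y - x)) has_real_derivative f (y - x)) (at y)" for y
      by (auto intro!: derivative_eq_intros)
    have "F (c - l - x) \<le> F (c + l - x)"
      by (rule DERIV_nonneg_imp_nondecreasing[of "c - l" "c + l" "\<lambda>y. F (y - x)"])
        (use l in \<open>auto intro!: exI[of _ "f (_ - x)"] F' nn[rule_format]\<close>)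
    moreover have "(\<integral>\<^sup>+y. ennreal (f (y - x)) * indicator {c - l..c + l} y \<partial>lborel)
        = ennreal (F (c + l - x) - F (c - l - x))"
    proof (rule nn_integral_FTC_Icc)
      show "(\<lambda>y. f (y - x)) \<in> borel_measurable borel"
        by (intro borel_measurable_continuous_onI continuous_on_compose2[OF cont] continuous_intros) auto
    qed (use l nn F' in \<open>auto intro: has_field_derivative_at_within\<close>)
    ultimately show "0 \<le> g (c - x) \<and>
      (\<integral>\<^sup>+y. ennreal (f (y - x)) * indicator {c - l..c + l} y \<partial>lborel) = ennreal (g (c - x))"
      by (simp add: g_def algebra_simps)
    qed
  qed
qed

text \<open>Sliding is applied to \<open>f\<close> in the variable \<open>x'\<close>, giving
  \<open>g\<close>, and then to \<open>g\<close> in \<open>x\<close>, giving \<open>G\<close>. The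
  double integral is \<open>G\<close> at the difference of the centres, and \<open>G\<close>
  strictly decreases in the absolute value.\<close>

lemma interval_pair_integral_less:
  fixes f :: "real \<Rightarrow> real"
  defines "I c l c' l' \<equiv> \<integral>\<^sup>+x. (\<integral>\<^sup>+x'. ennreal (f (x - x')) * indicator {c' - l'..c' + l'} x' \<partial>lborel)
      * indicator {c - l..c + l} x \<partial>lborel"
  assumes cont: "continuous_on UNIV f" and even: "\<And>u. f (- u) = f u"
    and dec: "\<And>u v. \<bar>u\<bar> < \<bar>v\<bar> \<Longrightarrow> f v < f u" and l: "0 < l" "0 < l'"
    and nn: "\<And>x x'. \<bar>x - c\<bar> \<le> l \<Longrightarrow> \<bar>x' - c'\<bar> \<le> l' \<Longrightarrow> 0 \<le> f (x - x')"
      "\<And>x x'. \<bar>x - d\<bar> \<le> l \<Longrightarrow> \<bar>x' - d'\<bar> \<le> l' \<Longrightarrow> 0 \<le> f (x - x')"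
    and less: "\<bar>c - c'\<bar> < \<bar>d - d'\<bar>"
  shows "I d l d' l' < I c l c' l'"
proof -
  have comm: "f (x - x') = f (x' - x)" for x x'
    using even[of "x - x'"] by simp
  obtain g where
    g: "continuous_on UNIV g" "\<And>u. g (- u) = g u" "\<And>u v. \<bar>u\<bar> < \<bar>v\<bar> \<Longrightarrow> g v < g u"
    and gI: "\<forall>c x. (\<forall>y\<in>{c - l'..c + l'}. 0 \<le> f (y - x)) \<longrightarrow> 0 \<le> g (c - x) \<and>
      (\<integral>\<^sup>+y. ennreal (f (y - x)) * indicator {c - l'..c + l'} y \<partial>lborel) = ennreal (g (c - x))"
    by (rule sliding_interval_integral[OF cont even dec l(2)]) (assumption, rule that, assumption+)
  obtain G where
    Gdec: "\<And>u v. \<bar>u\<bar> < \<bar>v\<bar> \<Longrightarrow> G v < G u"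
    and GI: "\<forall>c x. (\<forall>y\<in>{c - l..c + l}. 0 \<le> g (y - x)) \<longrightarrow> 0 \<le> G (c - x) \<and>
      (\<integral>\<^sup>+y. ennreal (g (y - x)) * indicator {c - l..c + l} y \<partial>lborel) = ennreal (G (c - x))"
    by (rule sliding_interval_integral[OF g l(1)]) (assumption, rule that, assumption+)
  have main: "0 \<le> G (c - c') \<and> I c l c' l' = ennreal (G (c - c'))"
    if nn: "\<And>x x'. \<bar>x - c\<bar> \<le> l \<Longrightarrow> \<bar>x' - c'\<bar> \<le> l' \<Longrightarrow> 0 \<le> f (x - x')" for c c'
  proof -
    have inner: "0 \<le> g (x - c') \<and>
        (\<integral>\<^sup>+x'. ennreal (f (x - x')) * indicator {c' - l'..c' + l'} x' \<partial>lborel) = ennreal (g (x - c'))"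
      if "x \<in> {c - l..c + l}" for x
    proof -
      \<comment> \<open>Evenness swaps the arguments, since the sliding lemma puts the integration
        variable first.\<close>
      have "0 \<le> f (y - x)" if "y \<in> {c' - l'..c' + l'}" for y
        using nn[of x y] that \<open>x \<in> _\<close> comm[of x y] by (auto simp: abs_le_iff)
      then show ?thesis
        using gI[rule_format, of c' x] g(2)[of "x - c'"] by (simp add: comm[of x])
    qed
    have "I c l c' l' = (\<integral>\<^sup>+x. ennreal (g (x - c')) * indicator {c - l..c + l} x \<partial>lborel)"
      unfolding I_def using inner by (intro nn_integral_cong) (auto simp: indicator_def)
    then show ?thesis using GI[rule_format, of c c'] inner by auto
  qed
  \<comment> \<open>Since \<open>G (d - d')\<close> is nonnegative, \<open>ennreal\<close> does not
    truncate the strict inequality.\<close>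
  show ?thesis
    using main[OF nn(1)] main[OF nn(2)] Gdec[OF less] by (auto simp: ennreal_less_iff)
qed

section \<open>Horizontal slices, area and diameter of the sheared triangle\<close>

text \<open>In barycentric coordinates the apex weight is \<open>u = y / h\<close>. The base weights
  \<open>v\<close>, \<open>w\<close> sum to \<open>1 - u\<close>, and
  \<open>x - s * u = (v - w) * a\<close> with \<open>v - w\<close> ranging over all of
  \<open>[-(1 - u), 1 - u]\<close>.\<close>

lemma triangle_slices:
  fixes a h s :: real
  assumes "0 < a" "0 < h"
  shows "(x, y) \<in> triangular_region (s, h) (a, 0) (- a, 0)
    \<longleftrightarrow> y \<in> {0..h} \<and> x \<in> {s * y / h - a * (1 - y / h)..s * y / h + a * (1 - y / h)}"
    (is "?L \<longleftrightarrow> ?R")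
proof
  assume ?L
  then obtain u v w where *: "0 \<le> u" "0 \<le> v" "0 \<le> w" "u + v + w = 1"
    "x = u * s + (v - w) * a" "y = u * h"
    unfolding triangular_region_def convex_hull_3 by (auto simp: algebra_simps)
  then have y: "y / h = u" and u: "1 - u = v + w" using assms by auto
  have "(v - w) * a \<le> (v + w) * a" "- (v + w) * a \<le> (v - w) * a"
    using * assms by (auto intro!: mult_right_mono)
  then have "x \<in> {s * (y / h) - a * (1 - y / h)..s * (y / h) + a * (1 - y / h)}"
    unfolding y u *(5) by (simp add: algebra_simps)
  moreover have "y \<in> {0..h}"
    using * assms mult_right_mono[of u 1 h] by simp
  ultimately show ?R by simp
next
  assume R: ?R
  define u where "u = y / h"
  \<comment> \<open>This is the difference \<open>v - w\<close> of the base weights, from which both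
    are recovered as \<open>(1 - u + e) / 2\<close> and \<open>(1 - u - e) / 2\<close>.\<close>
  define e where "e = (x - s * u) / a"
  have u: "0 \<le> u" "u \<le> 1" using R assms by (auto simp: u_def)
  have "x \<in> {s * u - a * (1 - u)..s * u + a * (1 - u)}"
    using R by (simp add: u_def)
  then have "- (1 - u) * a \<le> x - s * u" "x - s * u \<le> (1 - u) * a"
    by (auto simp: algebra_simps)
  then have e: "- (1 - u) \<le> e" "e \<le> 1 - u"
    unfolding e_def pos_le_divide_eq[OF assms(1)] pos_divide_le_eq[OF assms(1)] .
  have "(x, y) = u *\<^sub>R (s, h) + ((1 - u + e) / 2) *\<^sub>R (a, 0) + ((1 - u - e) / 2) *\<^sub>R (- a, 0)"
    using assms by (simp add: u_def e_def field_simps)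
  moreover have "0 \<le> (1 - u + e) / 2" "0 \<le> (1 - u - e) / 2" "u + (1 - u + e) / 2 + (1 - u - e) / 2 = 1"
    using e by (auto simp: field_simps)
  ultimately show ?L
    unfolding triangular_region_def convex_hull_3 using u by blast
qed

lemma triangle_borel: "triangular_region A B C \<in> sets borel"
  unfolding triangular_region_def
  by (intro borel_closed compact_imp_closed finite_imp_compact_convex_hull) simp

lemma nn_integral_triangle:
  fixes a h s :: real
  assumes ah: "0 < a" "0 < h" and f[measurable]: "f \<in> borel_measurable borel"
  shows "(\<integral>\<^sup>+z. f z * indicator (triangular_region (s, h) (a, 0) (- a, 0)) z \<partial>lborel)
    = (\<integral>\<^sup>+y. (\<integral>\<^sup>+x. f (x, y) *
        indicator {s * y / h - a * (1 - y / h)..s * y / h + a * (1 - y / h)} x \<partial>lborel) * indicator {0..h} y \<partial>lborel)"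
proof -
  note triangle_borel[measurable]
  let ?T = "triangular_region (s, h) (a, 0) (- a, 0)"
  have "(\<integral>\<^sup>+z. f z * indicator ?T z \<partial>lborel) = (\<integral>\<^sup>+z. f z * indicator ?T z \<partial>(lborel \<Otimes>\<^sub>M lborel))"
    by (simp add: lborel_prod)
  also have "\<dots> = (\<integral>\<^sup>+y. \<integral>\<^sup>+x. f (x, y) * indicator ?T (x, y) \<partial>lborel \<partial>lborel)"
    by (subst lborel_pair.nn_integral_snd[symmetric]) (auto simp: lborel_prod)
  also have "\<dots> = (\<integral>\<^sup>+y. \<integral>\<^sup>+x. (f (x, y) *
        indicator {s * y / h - a * (1 - y / h)..s * y / h + a * (1 - y / h)} x) * indicator {0..h} y \<partial>lborel \<partial>lborel)"
    by (intro nn_integral_cong) (auto simp: indicator_def triangle_slices[OF ah])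
  also have "\<dots> = (\<integral>\<^sup>+y. (\<integral>\<^sup>+x. f (x, y) *
        indicator {s * y / h - a * (1 - y / h)..s * y / h + a * (1 - y / h)} x \<partial>lborel) * indicator {0..h} y \<partial>lborel)"
    by (intro nn_integral_cong nn_integral_multc) auto
  finally show ?thesis .
qed

text \<open>The integral is left unevaluated: \<open>s\<close> has cancelled from the slice widths,
  and this shear invariance of the area is all that is needed.\<close>

lemma emeasure_triangle:
  fixes a h s :: real
  assumes ah: "0 < a" "0 < h"
  shows "emeasure lborel (triangular_region (s, h) (a, 0) (- a, 0))
    = (\<integral>\<^sup>+y. ennreal (2 * a * (1 - y / h)) * indicator {0..h} y \<partial>lborel)"
proof -
  have "emeasure lborel (triangular_region (s, h) (a, 0) (- a, 0))
    = (\<integral>\<^sup>+z. 1 * indicator (triangular_region (s, h) (a, 0) (- a, 0)) z \<partial>lborel)"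
    using triangle_borel by simp
  also have "\<dots> = (\<integral>\<^sup>+y. ennreal (2 * a * (1 - y / h)) * indicator {0..h} y \<partial>lborel)"
    unfolding nn_integral_triangle[OF ah borel_measurable_const]
  proof (intro nn_integral_cong)
    fix y
    show "(\<integral>\<^sup>+x. 1 * indicator {s * y / h - a * (1 - y / h)..s * y / h + a * (1 - y / h)} x \<partial>lborel) * indicator {0..h} y
      = ennreal (2 * a * (1 - y / h)) * indicator {0..h} y"
    proof (cases "y \<in> {0..h}")
      case True
      then have "0 \<le> a * (1 - y / h)" using ah by simp
      then have "s * y / h - a * (1 - y / h) \<le> s * y / h + a * (1 - y / h)" by simp
      moreover have "s * y / h + a * (1 - y / h) - (s * y / h - a * (1 - y / h)) = 2 * a * (1 - y / h)"
        by simp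
      ultimately show ?thesis by (simp add: mult.assoc)
    qed simp
  qed
  finally show ?thesis .
qed

text \<open>A ball is convex, so it contains the triangle once it contains the vertices. The crude
  bound serves to choose the radius \<open>R\<close>.\<close>

lemma triangle_diameter:
  fixes a h s :: real
  assumes ah: "0 < a" "0 < h" and "z \<in> triangular_region (s, h) (a, 0) (- a, 0)"
    "z' \<in> triangular_region (s, h) (a, 0) (- a, 0)"
  shows "norm (z - z') \<le> 2 * \<bar>s\<bar> + 2 * h + 2 * a"
proof -
  have "triangular_region (s, h) (a, 0) (- a, 0) \<subseteq> cball 0 (\<bar>s\<bar> + h + a)"
    unfolding triangular_region_def
  proof (rule hull_minimal)
    have "norm (s, h) \<le> norm s + norm h" by (rule norm_Pair_le)
    then show "{(s, h), (a, 0), (- a, 0)} \<subseteq> cball 0 (\<bar>s\<bar> + h + a)"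
      using ah by (simp add: norm_Pair)
  qed (rule convex_cball)
  with assms(3,4) have "norm z \<le> \<bar>s\<bar> + h + a" "norm z' \<le> \<bar>s\<bar> + h + a"
    by auto
  then show ?thesis using norm_triangle_ineq4[of z z'] by simp
qed

section \<open>Reduction to pairs of slices\<close>

text \<open>Tonelli brings the two heights outside, so that two triangles can be compared slice pair
  by slice pair. Measurability of \<open>\<Phi>\<close> is recorded for the later strict comparison
  of integrals.\<close>

lemma nn_integral_triangle_pair:
  fixes a h s :: real and f :: "real \<times> real \<Rightarrow> ennreal"
  defines "T \<equiv> triangular_region (s, h) (a, 0) (- a, 0)"
    and "S \<equiv> \<lambda>y. {s * y / h - a * (1 - y / h)..s * y / h + a * (1 - y / h)}"
  defines "\<Phi> \<equiv> \<lambda>(y, y'). (\<integral>\<^sup>+x. (\<integral>\<^sup>+x'. f (x - x', y - y') * indicator (S y') x' \<partial>lborel) * indicator (S y) x \<partial>lborel)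
      * indicator ({0..h} \<times> {0..h}) (y, y')"
  assumes ah: "0 < a" "0 < h" and f[measurable]: "f \<in> borel_measurable borel"
  shows "\<Phi> \<in> borel_measurable borel"
    and "(\<integral>\<^sup>+z. (\<integral>\<^sup>+z'. f (z - z') * indicator T z' \<partial>lborel) * indicator T z \<partial>lborel) = (\<integral>\<^sup>+p. \<Phi> p \<partial>lborel)"
proof -
  have f'[measurable]: "f \<in> borel_measurable (borel \<Otimes>\<^sub>M borel)"
    using f by (simp add: borel_prod)
  have [measurable]: "(\<lambda>(y, x). indicator (S y) x :: ennreal) \<in> borel_measurable (borel \<Otimes>\<^sub>M borel)"
  proof -
    \<comment> \<open>Writing membership in a moving interval as two inequalities gives joint
      measurability in \<open>y\<close> and \<open>x\<close>.\<close>
    have "(\<lambda>(y, x). indicator (S y) x :: ennreal) = (\<lambda>(y, x). if s * y / h - a * (1 - y / h) \<le> x \<and> x \<le> s * y / h + a * (1 - y / h) then 1 else 0)"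
      by (auto simp: S_def indicator_def fun_eq_iff)
    then show ?thesis by simp
  qed
  have \<Phi>: "\<Phi> \<in> borel_measurable (borel \<Otimes>\<^sub>M borel)"
    unfolding \<Phi>_def by measurable
  then show "\<Phi> \<in> borel_measurable borel"
    by (simp add: borel_prod)
  let ?J = "\<lambda>z. \<integral>\<^sup>+z'. f (z - z') * indicator T z' \<partial>lborel"
  have J: "?J (x, y) = (\<integral>\<^sup>+y'. (\<integral>\<^sup>+x'. f (x - x', y - y') * indicator (S y') x' \<partial>lborel) * indicator {0..h} y' \<partial>lborel)" for x y
    unfolding T_def S_def by (subst nn_integral_triangle[OF ah]) auto
  note triangle_borel[measurable]
  have "?J \<in> borel_measurable borel"
    unfolding T_def by measurable
  then have "(\<integral>\<^sup>+z. ?J z * indicator T z \<partial>lborel)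
    = (\<integral>\<^sup>+y. (\<integral>\<^sup>+x. ?J (x, y) * indicator (S y) x \<partial>lborel) * indicator {0..h} y \<partial>lborel)"
    unfolding T_def S_def by (rule nn_integral_triangle[OF ah])
  also have "\<dots> = (\<integral>\<^sup>+y. \<integral>\<^sup>+x. \<integral>\<^sup>+y'. (\<integral>\<^sup>+x'. f (x - x', y - y') * indicator (S y') x' \<partial>lborel)
      * indicator (S y) x * indicator ({0..h} \<times> {0..h}) (y, y') \<partial>lborel \<partial>lborel \<partial>lborel)"
    unfolding J
    by (subst nn_integral_multc[symmetric], measurable, intro nn_integral_cong,
        subst nn_integral_multc[symmetric], measurable, subst nn_integral_multc[symmetric], measurable)
      (auto intro!: nn_integral_cong simp: indicator_def)
  also have "\<dots> = (\<integral>\<^sup>+y. \<integral>\<^sup>+y'. \<integral>\<^sup>+x. (\<integral>\<^sup>+x'. f (x - x', y - y') * indicator (S y') x' \<partial>lborel)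
      * indicator (S y) x * indicator ({0..h} \<times> {0..h}) (y, y') \<partial>lborel \<partial>lborel \<partial>lborel)"
    by (intro nn_integral_cong lborel_pair.Fubini') measurable
  also have "\<dots> = (\<integral>\<^sup>+y. \<integral>\<^sup>+y'. \<Phi> (y, y') \<partial>lborel \<partial>lborel)"
    unfolding \<Phi>_def by (simp, intro nn_integral_cong nn_integral_multc) measurable
  also have "\<dots> = (\<integral>\<^sup>+p. \<Phi> p \<partial>(lborel \<Otimes>\<^sub>M lborel))"
    using \<Phi> by (intro lborel.nn_integral_fst) simp
  finally show "(\<integral>\<^sup>+z. ?J z * indicator T z \<partial>lborel) = (\<integral>\<^sup>+p. \<Phi> p \<partial>lborel)"
    by (simp add: lborel_prod)
qed

section \<open>Strict comparison of two sheared triangles\<close>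

text \<open>Discarded are equal heights, where the kernel may be singular, and the apex height
  \<open>h\<close>, where a slice shrinks to a point.\<close>

lemma AE_lborel_pair_generic:
  "AE p in (lborel :: (real \<times> real) measure). fst p \<noteq> snd p \<and> fst p \<noteq> h \<and> snd p \<noteq> h"
proof -
  have "AE p in lborel \<Otimes>\<^sub>M lborel. fst p \<noteq> snd p \<and> fst p \<noteq> h \<and> snd p \<noteq> (h :: real)"
  proof (rule lborel_pair.AE_pair_measure)
    show "AE x in lborel. AE y in lborel.
        fst (x, y) \<noteq> snd (x, y) \<and> fst (x, y) \<noteq> h \<and> snd (x, y) \<noteq> h"
      using AE_lborel_singleton[of h]
    proof eventually_elim
      case (elim x)
      show ?case
        using AE_lborel_singleton[of x] AE_lborel_singleton[of h]
        by eventually_elim (use elim in auto)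
    qed
  qed measurable
  then show ?thesis unfolding lborel_prod .
qed

text \<open>For generic heights in \<open>{0..h}\<close> the slices of \<open>T t\<close> have more
  distant centres than those of \<open>T s\<close>, so \<open>\<Phi> t < \<Phi> s\<close> there.
  Finiteness of \<open>N t\<close> keeps the inequality strict after integration.\<close>

lemma nn_integral_sheared_triangle_less:
  fixes K :: "real \<Rightarrow> real" and a h s t R :: real
  defines "T \<equiv> \<lambda>s. triangular_region (s, h) (a, 0) (- a, 0)"
  defines "N \<equiv> \<lambda>s. \<integral>\<^sup>+z. (\<integral>\<^sup>+z'. ennreal (K (norm (z - z')) - K R) * indicator (T s) z' \<partial>lborel) * indicator (T s) z \<partial>lborel"
  assumes cont: "continuous_on {0<..} K"
    and anti: "\<And>r s. 0 < r \<Longrightarrow> r < s \<Longrightarrow> K s < K r"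
    and ah: "0 < a" "0 < h" and st: "\<bar>s\<bar> < \<bar>t\<bar>"
    and R: "2 * \<bar>t\<bar> + 2 * h + 2 * a \<le> R" and fin: "N t < \<infinity>"
  shows "N t < N s"
proof -
  define l where "l y = a * (1 - y / h)" for y
  define \<Phi> where "\<Phi> s = (\<lambda>(y, y'). (\<integral>\<^sup>+x. (\<integral>\<^sup>+x'. ennreal (K (norm (x - x', y - y')) - K R)
      * indicator {s * y' / h - l y'..s * y' / h + l y'} x' \<partial>lborel)
      * indicator {s * y / h - l y..s * y / h + l y} x \<partial>lborel)
      * indicator ({0..h} \<times> {0..h}) (y, y'))" for s
  have [measurable]: "(\<lambda>z :: real \<times> real. K (norm z)) \<in> borel_measurable borel"
    by (rule borel_measurable_kernel[OF cont])
  have k: "(\<lambda>z :: real \<times> real. ennreal (K (norm z) - K R)) \<in> borel_measurable borel"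
    by measurable
  have \<Phi>_measurable: "\<Phi> u \<in> borel_measurable lborel" and N: "N u = (\<integral>\<^sup>+p. \<Phi> u p \<partial>lborel)" for u
    using nn_integral_triangle_pair[OF ah k, of u] by (simp_all add: \<Phi>_def N_def T_def l_def)
  have less: "\<Phi> t (y, y') < \<Phi> s (y, y')"
    if y: "y \<in> {0..h}" "y' \<in> {0..h}" "y \<noteq> y'" "y \<noteq> h" "y' \<noteq> h" for y y'
  proof -
    \<comment> \<open>The vertical offset \<open>y - y'\<close> is nonzero, so \<open>f\<close>
      avoids the singularity and is continuous on the whole line.\<close>
    define f where "f x = K (norm (x, y - y')) - K R" for x :: real
    have pos: "0 < norm (x, y - y')" for x :: real
      using y by (simp add: prod_eq_iff)
    \<comment> \<open>Both points lie in \<open>T u\<close>, whose diameter is at most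
      \<open>R\<close> when \<open>\<bar>u\<bar> \<le> \<bar>t\<bar>\<close>; this covers
      \<open>u = s\<close> and \<open>u = t\<close> together.\<close>
    have nn: "0 \<le> f (x - x')"
      if "\<bar>u\<bar> \<le> \<bar>t\<bar>" "\<bar>x - u * y / h\<bar> \<le> l y" "\<bar>x' - u * y' / h\<bar> \<le> l y'" for u x x'
    proof -
      have "(x, y) \<in> T u" "(x', y') \<in> T u"
        unfolding T_def triangle_slices[OF ah] using that y by (auto simp: l_def abs_le_iff)
      then have "norm ((x, y) - (x', y')) \<le> 2 * \<bar>u\<bar> + 2 * h + 2 * a"
        unfolding T_def by (rule triangle_diameter[OF ah])
      then have "norm (x - x', y - y') \<le> R" using that R by simp
      then show ?thesis
        using anti[OF pos[of "x - x'"], of R] by (cases "norm (x - x', y - y') = R") (auto simp: f_def)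
    qed
    have "(\<integral>\<^sup>+x. (\<integral>\<^sup>+x'. ennreal (f (x - x'))
        * indicator {t * y' / h - l y'..t * y' / h + l y'} x' \<partial>lborel)
        * indicator {t * y / h - l y..t * y / h + l y} x \<partial>lborel)
      < (\<integral>\<^sup>+x. (\<integral>\<^sup>+x'. ennreal (f (x - x'))
        * indicator {s * y' / h - l y'..s * y' / h + l y'} x' \<partial>lborel)
        * indicator {s * y / h - l y..s * y / h + l y} x \<partial>lborel)"
    proof (rule interval_pair_integral_less)
      show "continuous_on UNIV f"
        unfolding f_def using pos
        by (intro continuous_intros continuous_on_compose2[OF cont]) auto
      show "f (- u) = f u" for u
        by (simp add: f_def norm_Pair)
      show "f v < f u" if "\<bar>u\<bar> < \<bar>v\<bar>" for u v
      proof -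
        have "u\<^sup>2 < v\<^sup>2" using that by (metis abs_ge_zero power2_abs power_strict_mono zero_less_numeral)
        then have "norm (u, y - y') < norm (v, y - y')"
          by (simp add: norm_Pair)
        then show ?thesis using anti[OF pos] by (simp add: f_def)
      qed
      show "0 < l y" "0 < l y'"
        using y ah by (auto simp: l_def)
      have "s * y / h - s * y' / h = s * ((y - y') / h)" "t * y / h - t * y' / h = t * ((y - y') / h)"
        by (simp_all add: algebra_simps diff_divide_distrib)
      moreover have "0 < \<bar>(y - y') / h\<bar>" using y ah by simp
      ultimately show "\<bar>s * y / h - s * y' / h\<bar> < \<bar>t * y / h - t * y' / h\<bar>"
        using st by (simp only: abs_mult mult_strict_right_mono)
    qed (use nn[of t] nn[of s] st in auto)
    then show ?thesis using y by (simp add: \<Phi>_def f_def)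
  qed
  have "(\<integral>\<^sup>+p. \<Phi> t p \<partial>lborel) < (\<integral>\<^sup>+p. \<Phi> s p \<partial>lborel)"
  proof (rule nn_integral_less)
    show "(\<integral>\<^sup>+p. \<Phi> t p \<partial>lborel) \<noteq> \<infinity>" using fin N by simp
    show "AE p in lborel. \<Phi> t p \<le> \<Phi> s p"
      using AE_lborel_pair_generic[of h]
    proof eventually_elim
      case (elim p)
      obtain y y' where p: "p = (y, y')" by (cases p)
      show ?case
      proof (cases "p \<in> {0..h} \<times> {0..h}")
        case True
        then show ?thesis
          using less[of y y'] elim unfolding p by (auto intro: less_imp_le)
      next
        case False
        then show ?thesis unfolding p by (simp add: \<Phi>_def)
      qed
    qed
    \<comment> \<open>The reverse inequality would contradict strictness at generic points of the
      open square, making that square null although its side is \<open>h > 0\<close>.\<close>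
    show "\<not> (AE p in lborel. \<Phi> s p \<le> \<Phi> t p)"
    proof
      assume "AE p in lborel. \<Phi> s p \<le> \<Phi> t p"
      with AE_lborel_pair_generic[of h] have "AE p in lborel. p \<notin> box (0, 0) (h, h)"
      proof eventually_elim
        case (elim p)
        then show ?case
          using less[of "fst p" "snd p"] by (auto simp: box_prod not_le[symmetric])
      qed
      then have "emeasure lborel (box (0, 0) (h, h)) = 0"
        by (subst (asm) AE_iff_measurable[of "box (0, 0) (h, h)"]) auto
      then show False
        using ah by (simp add: emeasure_lborel_box_eq Basis_prod_def)
    qed
  qed (rule \<Phi>_measurable)+
  then show ?thesis by (simp add: N)
qed

section \<open>Monotonicity in the position of the apex\<close>

theorem theorem4p2:
  fixes K :: "real \<Rightarrow> real" and a b h :: real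
  assumes "K C1_differentiable_on {0<..}"
    and "strict_antimono_on {0<..} K"
    and "set_integrable lborel {0<..1} (\<lambda>r. K r * r)"
    and "a > 0" and "b > 0" and "h > 0"
  shows "strict_mono_on {..1} (\<lambda>t. D K (triangular_region ((t - 1) * b, h) (a, 0) (- a, 0)))"
proof (rule strict_mono_onI)
  fix p q :: real
  assume pq: "p \<in> {..1}" "q \<in> {..1}" "p < q"
  define t s where "t = (p - 1) * b" and "s = (q - 1) * b"
  \<comment> \<open>Here the range up to \<open>1\<close> enters: both offsets are nonpositive, so
    the larger parameter \<open>q\<close> has its apex closer to the axis of symmetry.\<close>
  have st: "\<bar>s\<bar> < \<bar>t\<bar>"
    using pq \<open>b > 0\<close> by (simp add: s_def t_def abs_mult)
  note ah = \<open>a > 0\<close> \<open>h > 0\<close>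
  \<comment> \<open>This bounds the diameter of every \<open>T u\<close> with
    \<open>\<bar>u\<bar> \<le> \<bar>t\<bar>\<close>; the summand \<open>1\<close> secures
    \<open>1 \<le> R\<close> for the finiteness of the kernel integral.\<close>
  define R where "R = 1 + 2 * \<bar>t\<bar> + 2 * h + 2 * a"
  define T where "T u = triangular_region (u, h) (a, 0) (- a, 0)" for u
  define N where "N u = (\<integral>\<^sup>+z. (\<integral>\<^sup>+z'. ennreal (K (norm (z - z')) - K R) * indicator (T u) z' \<partial>lborel)
    * indicator (T u) z \<partial>lborel)" for u
  have cont: "continuous_on {0<..} K"
    by (rule C1_differentiable_imp_continuous_on) fact
  have anti: "K r < K u" if "0 < u" "u < r" for u r
    using assms(2) that by (auto simp: monotone_on_def)
  have anti': "K r \<le> K u" if "0 < u" "u \<le> r" for u r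
    using anti[of u r] that by (cases "u = r") auto
  have int: "(\<integral>\<^sup>+z. ennreal (K (norm z) - K R) * indicator (cball 0 R) (z :: real \<times> real) \<partial>lborel) < \<infinity>"
    by (rule nn_integral_kernel_finite[OF cont assms(3) anti']) (use ah in \<open>auto simp: R_def\<close>)
  have T: "emeasure lborel (T u) < \<infinity>" for u
    unfolding T_def triangular_region_def
    by (intro emeasure_compact_finite finite_imp_compact_convex_hull) simp
  have "N u < \<infinity> \<and> D K (T u) = enn2real (N u) + K R * (measure lborel (T u))\<^sup>2"
    if "\<bar>u\<bar> \<le> \<bar>t\<bar>" for u
  proof -
    have diam: "norm (x - y) \<le> R" if "x \<in> T u" "y \<in> T u" for x y
      using triangle_diameter[OF ah that[unfolded T_def]] \<open>\<bar>u\<bar> \<le> \<bar>t\<bar>\<close> by (simp add: R_def)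
    have "T u \<in> sets borel" unfolding T_def by (rule triangle_borel)
    from D_eq_nn_integral[OF borel_measurable_kernel[OF cont] this T diam anti' int]
    show ?thesis by (simp add: N_def)
  qed
  note D = this[of s] this[of t]
  have "N t < N s"
    unfolding N_def T_def
    by (rule nn_integral_sheared_triangle_less[OF cont anti ah st])
      (use D(2) in \<open>auto simp: R_def N_def T_def\<close>)
  then have "enn2real (N t) < enn2real (N s)"
    using D st by (cases "N t" rule: ennreal_cases; cases "N s" rule: ennreal_cases) (auto simp: ennreal_less_iff)
  \<comment> \<open>With equal areas the terms \<open>K R * (measure lborel (T u))\<^sup>2\<close>
    coincide for \<open>u = s\<close> and \<open>u = t\<close>, whatever the sign of
    \<open>K R\<close>.\<close>
  moreover have "measure lborel (T t) = measure lborel (T s)"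
    by (simp add: measure_def T_def emeasure_triangle[OF ah])
  ultimately have "D K (T t) < D K (T s)"
    using D st by simp
  then show "D K (triangular_region ((p - 1) * b, h) (a, 0) (- a, 0))
      < D K (triangular_region ((q - 1) * b, h) (a, 0) (- a, 0))"
    by (simp add: T_def s_def t_def)
qed

end
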